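(* Let $\lambda$ be a nonempty Young diagram (a finite set of cells $(i,j)$, $i$ the row and $j$ the column, $i,j\geq1$, closed under moving up and left). Work over $\mathbb{Z}[x]=\mathbb{Z}[x_s:s\in\lambda]$. Let $(a,b)\notin\lambda$ be a cell of the border strip of $\lambda$, i.e. $(a,b)\notin\lambda$ and either $(a-1,b-1)\in\lambda$, or $a=1$ and $(1,b-1)\in\lambda$, or $b=1$ and $(a-1,1)\in\lambda$. Let $\lambda(i,j)=\{(u,v)\in\lambda: i\leq u,\ j\leq v\}$, $A_{ij}=F(\lambda(i,j))$, and $A(\lambda,\rho)=(A_{ij})_{1\leq i\leq a,\,1\leq j\leq b}$. Put $c=\min(a,b)$ and $U_\rho(i,k)=\{(u,v)\in\lambda: i\leq u<k\leq v+a-b\}$ ($1\leq i\leq k\leq a$), $L_\rho(l,j)=\{(u,v)\in\lambda: j\leq v<l\leq u+b-a\}$ ($1\leq j\leq l\leq b$), $d_i=\prod_{s\in\lambda(a-i+1,b-i+1)}x_s$ ($1\leq i\leq c$). Then $A(\lambda,\rho)=UDL$, where (i) $U=(U_{ik})_{1\leq i,k\leq a}$ is the upper unitriangular matrix with $U_{ik}=F(U_\rho(i,k))$ for $i\leq k$ and $0$ otherwise; (ii) $D=(D_{kl})_{1\leq k\leq a,\,1\leq l\leq b}$ with $D_{kl}=d_i$ if $(k,l)=(a-i+1,b-i+1)$ for some $1\leq i\leq c$, and $D_{kl}=0$ otherwise; (iii) $L=(L_{lj})_{1\leq l,j\leq b}$ is the lower unitriangular matrix with $L_{lj}=F(L_\rho(l,j))$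 for $j\leq l$ and $0$ otherwise.
   Context: For a finite set $S$ of cells, call $\mu\subseteq S$ an initial subshape of $S$ if whenever $(u,v)\in\mu$, $(u',v')\in S$, $u'\leq u$ and $v'\leq v$, then $(u',v')\in\mu$ (the empty set allowed). The generating function for skew shapes of $S$ is $F(S)=\sum_{\mu}\prod_{s\in S\setminus\mu}x_s$ over all initial subshapes $\mu$ of $S$; $F(\emptyset)=1$. Empty products equal $1$. ($\rho$ denotes the $a\times b$ rectangle with lower right cell $(a,b)$.) *)

theory Defs
  imports "HOL-Library.Poly_Mapping" "Jordan_Normal_Form.Matrix"
begin

text \<open>A cell is a pair (row, column), with both coordinates starting at 1.\<close>

type_synonym cell = "nat \<times> nat"

text \<open>Integer polynomials in the variables \<open>x\<^sub>s\<close>, where \<open>s\<close> ranges over all cells: a polynomial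
  maps monomials (finitely supported exponent functions) to integer coefficients.
  For a diagram \<open>\<Lambda>\<close>, the ring of integer polynomials in the \<open>x\<^sub>s\<close> with \<open>s \<in> \<Lambda>\<close> is a
  subring, and everything below that is formed from subsets of \<open>\<Lambda>\<close> lies in it.\<close>

type_synonym cell_poly = "(cell \<Rightarrow>\<^sub>0 nat) \<Rightarrow>\<^sub>0 int"

definition X :: "cell \<Rightarrow> cell_poly" where
  "X s = Poly_Mapping.single (Poly_Mapping.single s 1) 1"

definition young_diagram :: "cell set \<Rightarrow> bool" where
  "young_diagram S \<longleftrightarrow>
     finite S \<and>
     (\<forall>(i, j) \<in> S. 1 \<le> i \<and> 1 \<le> j) \<and>
     (\<forall>i j i' j'. (i, j) \<in> S \<longrightarrow> 1 \<le> i' \<longrightarrow> i' \<le> i \<longrightarrow> 1 \<le> j' \<longrightarrow> j' \<le> j \<longrightarrow> (i', j') \<in> S)"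

definition initial_subshape :: "cell set \<Rightarrow> cell set \<Rightarrow> bool" where
  "initial_subshape \<mu> S \<longleftrightarrow>
     \<mu> \<subseteq> S \<and>
     (\<forall>u v u' v'. (u, v) \<in> \<mu> \<longrightarrow> (u', v') \<in> S \<longrightarrow> u' \<le> u \<longrightarrow> v' \<le> v \<longrightarrow> (u', v') \<in> \<mu>)"

definition skew_gf :: "cell set \<Rightarrow> cell_poly" where
  "skew_gf S = (\<Sum>\<mu> \<in> {\<mu>. initial_subshape \<mu> S}. \<Prod>s \<in> S - \<mu>. X s)"

text \<open>The truncated subtractions are harmless: cells of a Young diagram have positive coordinates,
  so a membership \<open>(a - 1, b - 1) \<in> \<Lambda>\<close> forces \<open>a, b \<ge> 2\<close>, and similarly in the other cases.\<close>

definition outer_border_cell :: "cell set \<Rightarrow> nat \<Rightarrow> nat \<Rightarrow> bool" where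
  "outer_border_cell \<Lambda> a b \<longleftrightarrow>
     1 \<le> a \<and> 1 \<le> b \<and> (a, b) \<notin> \<Lambda> \<and>
     ((a - 1, b - 1) \<in> \<Lambda> \<or> (a = 1 \<and> (1, b - 1) \<in> \<Lambda>) \<or> (b = 1 \<and> (a - 1, 1) \<in> \<Lambda>))"

definition subdiagram :: "cell set \<Rightarrow> nat \<Rightarrow> nat \<Rightarrow> cell set" where
  "subdiagram \<Lambda> i j = {(u, v) \<in> \<Lambda>. i \<le> u \<and> j \<le> v}"

text \<open>The conditions \<open>k \<le> v + a - b\<close> and \<open>l \<le> u + b - a\<close> on integers are stated without
  subtraction.\<close>

definition U_cells :: "cell set \<Rightarrow> nat \<Rightarrow> nat \<Rightarrow> nat \<Rightarrow> nat \<Rightarrow> cell set" where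
  "U_cells \<Lambda> a b i k = {(u, v) \<in> \<Lambda>. i \<le> u \<and> u < k \<and> k + b \<le> v + a}"

definition L_cells :: "cell set \<Rightarrow> nat \<Rightarrow> nat \<Rightarrow> nat \<Rightarrow> nat \<Rightarrow> cell set" where
  "L_cells \<Lambda> a b l j = {(u, v) \<in> \<Lambda>. j \<le> v \<and> v < l \<and> l + a \<le> u + b}"

definition diag_entry :: "cell set \<Rightarrow> nat \<Rightarrow> nat \<Rightarrow> nat \<Rightarrow> cell_poly" where
  "diag_entry \<Lambda> a b i = (\<Prod>s \<in> subdiagram \<Lambda> (a - i + 1) (b - i + 1). X s)"

text \<open>The type of matrices indexes entries from 0; \<open>mat1 m n f\<close> is the \<open>m \<times> n\<close> matrix
  \<open>(f i j)\<close> with \<open>1 \<le> i \<le> m\<close> and \<open>1 \<le> j \<le> n\<close>.\<close>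

definition mat1 :: "nat \<Rightarrow> nat \<Rightarrow> (nat \<Rightarrow> nat \<Rightarrow> 'a) \<Rightarrow> 'a mat" where
  "mat1 m n f = mat m n (\<lambda>(i, j). f (i + 1) (j + 1))"

definition upper_unitriangular :: "'a :: {zero, one} mat \<Rightarrow> bool" where
  "upper_unitriangular M \<longleftrightarrow>
     square_mat M \<and> upper_triangular M \<and> (\<forall>i < dim_row M. M $$ (i, i) = 1)"

definition lower_unitriangular :: "'a :: {zero, one} mat \<Rightarrow> bool" where
  "lower_unitriangular M \<longleftrightarrow> upper_unitriangular (transpose_mat M)"

definition A_mat :: "cell set \<Rightarrow> nat \<Rightarrow> nat \<Rightarrow> cell_poly mat" where
  "A_mat \<Lambda> a b = mat1 a b (\<lambda>i j. skew_gf (subdiagram \<Lambda> i j))"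

definition U_mat :: "cell set \<Rightarrow> nat \<Rightarrow> nat \<Rightarrow> cell_poly mat" where
  "U_mat \<Lambda> a b = mat1 a a (\<lambda>i k. if i \<le> k then skew_gf (U_cells \<Lambda> a b i k) else 0)"

text \<open>If \<open>(k, l) = (a - i + 1, b - i + 1)\<close> with \<open>1 \<le> i \<le> min a b\<close>, then \<open>i = a - k + 1\<close>.\<close>

definition D_mat :: "cell set \<Rightarrow> nat \<Rightarrow> nat \<Rightarrow> cell_poly mat" where
  "D_mat \<Lambda> a b = mat1 a b (\<lambda>k l.
     if \<exists>i \<in> {1..min a b}. (k, l) = (a - i + 1, b - i + 1)
     then diag_entry \<Lambda> a b (a - k + 1) else 0)"

definition L_mat :: "cell set \<Rightarrow> nat \<Rightarrow> nat \<Rightarrow> cell_poly mat" where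
  "L_mat \<Lambda> a b = mat1 b b (\<lambda>l j. if j \<le> l then skew_gf (L_cells \<Lambda> a b l j) else 0)"

end

theory Submission
  imports Defs
begin

text \<open>Fix \<open>(i, j)\<close> and walk down the diagonal of the cells \<open>(k, l)\<close> with \<open>k - l = a - b\<close>. An initial
  subshape \<open>\<mu>\<close> of \<open>\<lambda>(i, j)\<close> determines the first cell \<open>(k, l)\<close> of the diagonal outside \<open>\<mu>\<close>.
  Then \<open>\<mu>\<close> contains the whole rectangle of rows \<open>i, \<dots>, k - 1\<close> and columns \<open>j, \<dots>, l - 1\<close>,
  misses \<open>\<lambda>(k, l)\<close>, and its parts to the right of and below the rectangle are independent
  initial subshapes of \<open>U\<^sub>\<rho>(i, k)\<close> and \<open>L\<^sub>\<rho>(l, j)\<close>. Summing over \<open>\<mu>\<close> according to \<open>(k, l)\<close>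
  gives the \<open>(i, j)\<close> entry of the product \<open>UDL\<close>.\<close>

lemma finite_initial_subshapes:
  "finite S \<Longrightarrow> finite {\<mu>. initial_subshape \<mu> S}"
  by (rule finite_subset[of _ "Pow S"]) (auto simp: initial_subshape_def)

lemma skew_gf_empty [simp]: "skew_gf {} = 1"
proof -
  have "{\<mu>. initial_subshape \<mu> {}} = {{}}"
    by (auto simp: initial_subshape_def)
  then show ?thesis
    by (simp add: skew_gf_def)
qed

text \<open>Such a \<open>\<mu>\<close> is \<open>R\<close> together with its traces on
  \<open>U\<close> and \<open>L\<close>. By \<open>RU\<close> and \<open>RL\<close>, no cell of
  \<open>L\<close> lies weakly above and to the left of a cell of \<open>U\<close>, nor the other
  way round, so the two traces vary independently; the avoided cells of \<open>D\<close> contribute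
  the constant factor.\<close>

lemma sum_initial_subshapes_between:
  assumes fin: "finite S"
    and S: "S = R \<union> U \<union> L \<union> D"
    and disj: "R \<inter> U = {}" "R \<inter> L = {}" "R \<inter> D = {}" "U \<inter> L = {}" "U \<inter> D = {}" "L \<inter> D = {}"
    and RU: "initial_subshape (R \<union> U) S"
    and RL: "initial_subshape (R \<union> L) S"
  shows "(\<Sum>\<mu> | initial_subshape \<mu> S \<and> R \<subseteq> \<mu> \<and> \<mu> \<inter> D = {}. \<Prod>s\<in>S - \<mu>. X s)
    = skew_gf U * (\<Prod>s\<in>D. X s) * skew_gf L"
proof -
  have fins: "finite U" "finite L" "finite D"
    using fin S by auto
  have "skew_gf U * (\<Prod>s\<in>D. X s) * skew_gf L
    = (\<Sum>(\<mu>, \<nu>)\<in>{\<mu>. initial_subshape \<mu> U} \<times> {\<nu>. initial_subshape \<nu> L}.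
        (\<Prod>s\<in>U - \<mu>. X s) * (\<Prod>s\<in>D. X s) * (\<Prod>s\<in>L - \<nu>. X s))"
    unfolding skew_gf_def
    \<comment> \<open>The instance absorbs only the factor \<open>prod X D\<close> into the first
      sum; what remains is a product of two sums, as \<open>sum_product\<close> requires.\<close>
    by (simp only: sum_distrib_right[of _ _ "prod X D"] sum_product sum.cartesian_product)
  also have "\<dots> = (\<Sum>\<mu> | initial_subshape \<mu> S \<and> R \<subseteq> \<mu> \<and> \<mu> \<inter> D = {}. \<Prod>s\<in>S - \<mu>. X s)"
  proof (rule sum.reindex_bij_witness
      [where i = "\<lambda>\<mu>. (\<mu> \<inter> U, \<mu> \<inter> L)" and j = "\<lambda>(\<mu>, \<nu>). R \<union> \<mu> \<union> \<nu>"])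
    fix p
    assume p: "p \<in> {\<mu>. initial_subshape \<mu> U} \<times> {\<nu>. initial_subshape \<nu> L}"
    obtain \<mu> \<nu> where [simp]: "p = (\<mu>, \<nu>)" by fastforce
    have \<mu>: "initial_subshape \<mu> U" and \<nu>: "initial_subshape \<nu> L"
      using p by auto
    have sub: "\<mu> \<subseteq> U" "\<nu> \<subseteq> L"
      using \<mu> \<nu> by (auto simp: initial_subshape_def)
    show "((case p of (\<mu>, \<nu>) \<Rightarrow> R \<union> \<mu> \<union> \<nu>) \<inter> U, (case p of (\<mu>, \<nu>) \<Rightarrow> R \<union> \<mu> \<union> \<nu>) \<inter> L) = p"
      using sub disj by auto
    have "initial_subshape (R \<union> \<mu> \<union> \<nu>) S"
      unfolding initial_subshape_def
    proof (intro conjI allI impI)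
      show "R \<union> \<mu> \<union> \<nu> \<subseteq> S"
        using sub S by auto
      fix u v u' v'
      assume in_\<mu>: "(u, v) \<in> R \<union> \<mu> \<union> \<nu>" and le: "(u', v') \<in> S" "u' \<le> u" "v' \<le> v"
      \<comment> \<open>A cell of \<open>S\<close> above and to the left of a cell of
        \<open>R\<close> lies in both unions, whose intersection is \<open>R\<close> since
        \<open>U\<close> and \<open>L\<close> are disjoint. For a cell of \<open>\<mu>\<close> or
        \<open>\<nu>\<close> it lies in \<open>R\<close> or in the same part \<open>U\<close> or
        \<open>L\<close>, where the closure of \<open>\<mu>\<close> or \<open>\<nu>\<close>
        applies.\<close>
      have "(u, v) \<in> R \<union> U \<Longrightarrow> (u', v') \<in> R \<union> U" "(u, v) \<in> R \<union> L \<Longrightarrow> (u', v') \<in> R \<union> L"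
        using RU RL le unfolding initial_subshape_def by blast+
      moreover have "(u, v) \<in> \<mu> \<Longrightarrow> (u', v') \<in> U \<Longrightarrow> (u', v') \<in> \<mu>"
        "(u, v) \<in> \<nu> \<Longrightarrow> (u', v') \<in> L \<Longrightarrow> (u', v') \<in> \<nu>"
        using \<mu> \<nu> le unfolding initial_subshape_def by blast+
      ultimately show "(u', v') \<in> R \<union> \<mu> \<union> \<nu>"
        using in_\<mu> sub disj by blast
    qed
    then show "(case p of (\<mu>, \<nu>) \<Rightarrow> R \<union> \<mu> \<union> \<nu>) \<in> {\<mu>. initial_subshape \<mu> S \<and> R \<subseteq> \<mu> \<and> \<mu> \<inter> D = {}}"
      using sub disj by auto
    have "S - (R \<union> \<mu> \<union> \<nu>) = (U - \<mu>) \<union> D \<union> (L - \<nu>)"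
      using S sub disj by auto
    moreover have "(\<Prod>s\<in>(U - \<mu>) \<union> D \<union> (L - \<nu>). X s)
      = (\<Prod>s\<in>U - \<mu>. X s) * (\<Prod>s\<in>D. X s) * (\<Prod>s\<in>L - \<nu>. X s)"
      using fins disj by (subst prod.union_disjoint; (subst prod.union_disjoint)?) auto
    ultimately show "(\<Prod>s\<in>S - (case p of (\<mu>, \<nu>) \<Rightarrow> R \<union> \<mu> \<union> \<nu>). X s)
      = (case p of (\<mu>, \<nu>) \<Rightarrow> (\<Prod>s\<in>U - \<mu>. X s) * (\<Prod>s\<in>D. X s) * (\<Prod>s\<in>L - \<nu>. X s))"
      by simp
  next
    fix \<mu>
    assume "\<mu> \<in> {\<mu>. initial_subshape \<mu> S \<and> R \<subseteq> \<mu> \<and> \<mu> \<inter> D = {}}"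
    then have \<mu>: "initial_subshape \<mu> S" "R \<subseteq> \<mu>" "\<mu> \<inter> D = {}" by auto
    show "(case (\<mu> \<inter> U, \<mu> \<inter> L) of (\<mu>, \<nu>) \<Rightarrow> R \<union> \<mu> \<union> \<nu>) = \<mu>"
      using \<mu> S by (auto simp: initial_subshape_def)
    have "initial_subshape (\<mu> \<inter> T) T" if "T \<subseteq> S" for T
      using \<mu>(1) that unfolding initial_subshape_def by blast
    then show "(\<mu> \<inter> U, \<mu> \<inter> L) \<in> {\<mu>. initial_subshape \<mu> U} \<times> {\<nu>. initial_subshape \<nu> L}"
      using S by auto
  qed
  finally show ?thesis by simp
qed

lemma finite_subdiagram: "finite \<Lambda> \<Longrightarrow> finite (subdiagram \<Lambda> i j)"
  by (rule finite_subset[of _ \<Lambda>]) (auto simp: subdiagram_def)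

lemma skew_gf_subdiagram:
  assumes yd: "young_diagram \<Lambda>"
    and ob: "outer_border_cell \<Lambda> a b"
    and ij: "1 \<le> i" "i \<le> a" "1 \<le> j" "j \<le> b"
  shows "skew_gf (subdiagram \<Lambda> i j)
    = (\<Sum>(k, l)\<in>{(k, l). i \<le> k \<and> k \<le> a \<and> j \<le> l \<and> l \<le> b \<and> k + b = l + a}.
        skew_gf (U_cells \<Lambda> a b i k) * (\<Prod>s\<in>subdiagram \<Lambda> k l. X s) * skew_gf (L_cells \<Lambda> a b l j))"
proof -
  define S where "S = subdiagram \<Lambda> i j"
  define diagonal where
    "diagonal = {(k, l). i \<le> k \<and> k \<le> a \<and> j \<le> l \<and> l \<le> b \<and> k + b = l + a}"
  define R where "R = (\<lambda>(k, l). {i..<k} \<times> {j..<l})"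
  define I where "I = (\<lambda>(k, l). {\<mu>. initial_subshape \<mu> S \<and> R (k, l) \<subseteq> \<mu> \<and> \<mu> \<inter> subdiagram \<Lambda> k l = {}})"
  have fin: "finite \<Lambda>" and down: "\<And>u v u' v'. (u, v) \<in> \<Lambda> \<Longrightarrow> 1 \<le> u' \<Longrightarrow> u' \<le> u \<Longrightarrow> 1 \<le> v' \<Longrightarrow> v' \<le> v \<Longrightarrow> (u', v') \<in> \<Lambda>"
    using yd unfolding young_diagram_def by blast+
  have ab: "(a, b) \<notin> \<Lambda>"
    using ob by (simp add: outer_border_cell_def)
  have finS: "finite S"
    using fin by (simp add: S_def finite_subdiagram)
  have fin_diag: "finite diagonal"
    by (rule finite_subset[of _ "{..a} \<times> {..b}"]) (auto simp: diagonal_def)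
  have R_sub: "R (k, l) \<subseteq> S" if "(k, l) \<in> diagonal" for k l
  proof
    fix s assume "s \<in> R (k, l)"
    then obtain u v where s: "s = (u, v)" and uv: "i \<le> u" "u < k" "j \<le> v" "v < l"
      by (auto simp: R_def)
    have kl: "k \<le> a" "l \<le> b"
      using that by (auto simp: diagonal_def)
    \<comment> \<open>A cell of the rectangle satisfies 1 \<le> u < a and 1 \<le> v < b, which
      excludes the border cases \<open>a = 1\<close> and \<open>b = 1\<close>.\<close>
    have "(a - 1, b - 1) \<in> \<Lambda>"
      using ob uv kl ij by (auto simp: outer_border_cell_def)
    then have "(u, v) \<in> \<Lambda>"
      by (rule down) (use uv kl ij in auto)
    then show "s \<in> S"
      using s uv by (simp add: S_def subdiagram_def)
  qed
  have cover: "{\<mu>. initial_subshape \<mu> S} = (\<Union>p\<in>diagonal. I p)"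
  proof (intro equalityI subsetI)
    fix \<mu> assume "\<mu> \<in> {\<mu>. initial_subshape \<mu> S}"
    then have \<mu>: "initial_subshape \<mu> S" by simp
    then have \<mu>S: "\<mu> \<subseteq> S"
      and \<mu>_down: "\<And>u v u' v'. (u, v) \<in> \<mu> \<Longrightarrow> (u', v') \<in> S \<Longrightarrow> u' \<le> u \<Longrightarrow> v' \<le> v \<Longrightarrow> (u', v') \<in> \<mu>"
      unfolding initial_subshape_def by blast+
    \<comment> \<open>The walk ends at \<open>(a, b)\<close> at the latest, which is on the diagonal
      but outside \<open>\<Lambda>\<close>. Minimising the row suffices, because on the diagonal it
      determines the column.\<close>
    have ex: "\<exists>k. \<exists>l. (k, l) \<in> diagonal \<and> (k, l) \<notin> \<mu>"
      using ij ab \<mu>S by (intro exI[of _ a] exI[of _ b]) (auto simp: diagonal_def S_def subdiagram_def)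
    define k where "k = (LEAST k. \<exists>l. (k, l) \<in> diagonal \<and> (k, l) \<notin> \<mu>)"
    obtain l where kl: "(k, l) \<in> diagonal" "(k, l) \<notin> \<mu>"
      using LeastI_ex[OF ex] unfolding k_def by blast
    have first: "(k', l') \<in> \<mu>" if "(k', l') \<in> diagonal" "k' < k" for k' l'
      using not_less_Least[of k' "\<lambda>k. \<exists>l. (k, l) \<in> diagonal \<and> (k, l) \<notin> \<mu>"] that
      unfolding k_def by blast
    have "R (k, l) \<subseteq> \<mu>"
    proof
      fix s assume sR: "s \<in> R (k, l)"
      then obtain u v where s: "s = (u, v)" and uv: "i \<le> u" "u < k" "j \<le> v" "v < l"
        by (auto simp: R_def)
      \<comment> \<open>As the rectangle has a cell, i < k and j < l, so this is the preceding
        diagonal cell and also the lower right corner of the rectangle.\<close>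
      have "(k - 1, l - 1) \<in> \<mu>"
        by (rule first) (use uv kl(1) in \<open>auto simp: diagonal_def\<close>)
      then have "(u, v) \<in> \<mu>"
        by (rule \<mu>_down) (use uv R_sub[OF kl(1)] sR s in auto)
      then show "s \<in> \<mu>" by (simp add: s)
    qed
    moreover have "\<mu> \<inter> subdiagram \<Lambda> k l = {}"
    proof (rule ccontr)
      assume "\<mu> \<inter> subdiagram \<Lambda> k l \<noteq> {}"
      then obtain u v where uv: "(u, v) \<in> \<mu>" "(u, v) \<in> \<Lambda>" "k \<le> u" "l \<le> v"
        by (auto simp: subdiagram_def)
      \<comment> \<open>The cell \<open>(k, l)\<close> itself may lie outside
        \<open>\<Lambda>\<close>, but not if \<open>\<Lambda>\<close> has a cell weakly below and to
        the right of it.\<close>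
      have "(k, l) \<in> \<Lambda>"
        by (rule down[OF uv(2)]) (use uv kl(1) ij in \<open>auto simp: diagonal_def\<close>)
      then have "(k, l) \<in> S"
        using kl(1) by (simp add: S_def subdiagram_def diagonal_def)
      then show False
        using \<mu>_down[OF uv(1)] uv(3,4) kl(2) by blast
    qed
    ultimately show "\<mu> \<in> (\<Union>p\<in>diagonal. I p)"
      using kl(1) \<mu> by (auto simp: I_def)
  qed (auto simp: I_def)
  have excl: False
    if "(k, l) \<in> diagonal" "(k', l') \<in> diagonal" "k < k'" "\<mu> \<in> I (k, l)" "\<mu> \<in> I (k', l')"
    for k l k' l' \<mu>
  proof -
    \<comment> \<open>The earlier diagonal cell lies in the rectangle of the later one, so
      \<open>\<mu>\<close> would have to contain it and avoid it.\<close>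
    have "(k, l) \<in> R (k', l')"
      using that(1-3) by (auto simp: R_def diagonal_def)
    then have "(k, l) \<in> \<mu>" "(k, l) \<in> S"
      using that(5) R_sub[OF that(2)] by (auto simp: I_def)
    then show False
      using that(4) by (auto simp: I_def S_def subdiagram_def)
  qed
  have disj: "I p \<inter> I q = {}" if pq: "p \<in> diagonal" "q \<in> diagonal" "p \<noteq> q" for p q
  proof -
    obtain k l k' l' where [simp]: "p = (k, l)" "q = (k', l')" by fastforce
    have "k < k' \<or> k' < k"
      using pq by (auto simp: diagonal_def)
    then show ?thesis
      using excl[of k l k' l'] excl[of k' l' k l] pq by auto
  qed
  have part: "(\<Sum>\<mu>\<in>I (k, l). \<Prod>s\<in>S - \<mu>. X s)
    = skew_gf (U_cells \<Lambda> a b i k) * (\<Prod>s\<in>subdiagram \<Lambda> k l. X s) * skew_gf (L_cells \<Lambda> a b l j)"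
    if kl: "(k, l) \<in> diagonal" for k l
  proof -
    \<comment> \<open>On the diagonal, k + b \<le> v + a means l \<le> v, and l + a \<le> u + b
      means k \<le> u. The four pieces are thus the quadrants into which row k and column l cut
      \<open>S\<close>.\<close>
    have U: "(u, v) \<in> U_cells \<Lambda> a b i k \<longleftrightarrow> (u, v) \<in> \<Lambda> \<and> i \<le> u \<and> u < k \<and> l \<le> v"
      and L: "(u, v) \<in> L_cells \<Lambda> a b l j \<longleftrightarrow> (u, v) \<in> \<Lambda> \<and> j \<le> v \<and> v < l \<and> k \<le> u"
      and D: "(u, v) \<in> subdiagram \<Lambda> k l \<longleftrightarrow> (u, v) \<in> \<Lambda> \<and> k \<le> u \<and> l \<le> v"
      and S: "(u, v) \<in> S \<longleftrightarrow> (u, v) \<in> \<Lambda> \<and> i \<le> u \<and> j \<le> v"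
      for u v
      using kl by (auto simp: diagonal_def U_cells_def L_cells_def subdiagram_def S_def)
    have R: "(u, v) \<in> R (k, l) \<longleftrightarrow> (u, v) \<in> \<Lambda> \<and> i \<le> u \<and> u < k \<and> j \<le> v \<and> v < l" for u v
      using subsetD[OF R_sub[OF kl], of "(u, v)"] S[of u v] by (auto simp: R_def)
    have le: "i \<le> k" "j \<le> l"
      using kl by (auto simp: diagonal_def)
    show ?thesis
      unfolding I_def prod.case
    proof (rule sum_initial_subshapes_between[OF finS])
      show "S = R (k, l) \<union> U_cells \<Lambda> a b i k \<union> L_cells \<Lambda> a b l j \<union> subdiagram \<Lambda> k l"
        using le by (auto simp: U L D S R)
      \<comment> \<open>These unions are the part of \<open>S\<close> in rows above k and the part
        in columns left of l.\<close>
      show "initial_subshape (R (k, l) \<union> U_cells \<Lambda> a b i k) S"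
        "initial_subshape (R (k, l) \<union> L_cells \<Lambda> a b l j) S"
        using le by (auto simp: initial_subshape_def U L S R)
    qed (auto simp: U L D R)
  qed
  have "skew_gf S = (\<Sum>p\<in>diagonal. \<Sum>\<mu>\<in>I p. \<Prod>s\<in>S - \<mu>. X s)"
    unfolding skew_gf_def cover
  proof (rule sum.UNION_disjoint[OF fin_diag])
    show "\<forall>p\<in>diagonal. finite (I p)"
      using finite_initial_subshapes[OF finS] by (auto simp: I_def)
  qed (use disj in blast)
  also have "\<dots> = (\<Sum>(k, l)\<in>diagonal. skew_gf (U_cells \<Lambda> a b i k)
      * (\<Prod>s\<in>subdiagram \<Lambda> k l. X s) * skew_gf (L_cells \<Lambda> a b l j))"
    by (rule sum.cong) (auto simp: part)
  finally show ?thesis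
    by (simp only: S_def diagonal_def)
qed

lemma mat1_mult:
  fixes f :: "nat \<Rightarrow> nat \<Rightarrow> 'a :: semiring_0"
  shows "mat1 m n f * mat1 n p g = mat1 m p (\<lambda>i j. \<Sum>k = 1..n. f i k * g k j)"
  by (rule eq_matI)
    (auto simp: mat1_def scalar_prod_def sum.atLeast1_atMost_eq lessThan_atLeast0)

theorem theorem5p4:
  fixes \<Lambda> :: "cell set" and a b :: nat
  assumes "young_diagram \<Lambda>"
    and "\<Lambda> \<noteq> {}"
    and "outer_border_cell \<Lambda> a b"
  shows "A_mat \<Lambda> a b = U_mat \<Lambda> a b * D_mat \<Lambda> a b * L_mat \<Lambda> a b
    \<and> upper_unitriangular (U_mat \<Lambda> a b)
    \<and> lower_unitriangular (L_mat \<Lambda> a b)"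
proof (intro conjI)
  define U where "U = (\<lambda>i k. if i \<le> k then skew_gf (U_cells \<Lambda> a b i k) else 0)"
  define L where "L = (\<lambda>l j. if j \<le> l then skew_gf (L_cells \<Lambda> a b l j) else 0)"
  define D where "D = (\<lambda>k l. if k + b = l + a then \<Prod>s\<in>subdiagram \<Lambda> k l. X s else 0)"
  have D_mat: "D_mat \<Lambda> a b = mat1 a b D"
  proof -
    have "(\<exists>i\<in>{1..min a b}. (k, l) = (a - i + 1, b - i + 1)) \<longleftrightarrow> k + b = l + a"
      if "1 \<le> k" "k \<le> a" "1 \<le> l" "l \<le> b" for k l
    proof
      assume "k + b = l + a"
      then show "\<exists>i\<in>{1..min a b}. (k, l) = (a - i + 1, b - i + 1)"
        \<comment> \<open>Since a - k = b - l, the witness is at most both a and b and gives back k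
          and l.\<close>
        using that by (intro bexI[of _ "a - k + 1"]) auto
    qed (use that in auto)
    moreover have "diag_entry \<Lambda> a b (a - k + 1) = (\<Prod>s\<in>subdiagram \<Lambda> k l. X s)"
      if "1 \<le> k" "k \<le> a" "1 \<le> l" "l \<le> b" "k + b = l + a" for k l
    proof -
      have "a - (a - k + 1) + 1 = k" "b - (a - k + 1) + 1 = l"
        using that by auto
      then show ?thesis
        by (simp only: diag_entry_def)
    qed
    ultimately have "(if \<exists>i\<in>{1..min a b}. (k, l) = (a - i + 1, b - i + 1)
        then diag_entry \<Lambda> a b (a - k + 1) else 0) = D k l"
      if "1 \<le> k" "k \<le> a" "1 \<le> l" "l \<le> b" for k l
      using that by (simp only: D_def) simp
    then show ?thesis
      unfolding D_mat_def mat1_def by (intro cong_mat refl) (simp only: prod.case)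
  qed
  have entry: "skew_gf (subdiagram \<Lambda> i j) = (\<Sum>l = 1..b. (\<Sum>k = 1..a. U i k * D k l) * L l j)"
    if ij: "1 \<le> i" "i \<le> a" "1 \<le> j" "j \<le> b" for i j
  proof -
    have "(\<Sum>l = 1..b. (\<Sum>k = 1..a. U i k * D k l) * L l j)
      = (\<Sum>k = 1..a. \<Sum>l = 1..b. U i k * D k l * L l j)"
      by (simp only: sum_distrib_right) (rule sum.swap)
    also have "\<dots> = (\<Sum>(k, l)\<in>{1..a} \<times> {1..b}. U i k * D k l * L l j)"
      by (rule sum.cartesian_product)
    also have "\<dots> = (\<Sum>(k, l)\<in>{(k, l). i \<le> k \<and> k \<le> a \<and> j \<le> l \<and> l \<le> b \<and> k + b = l + a}.
        U i k * D k l * L l j)"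
      \<comment> \<open>The omitted terms vanish: \<open>U i k\<close> for k < i,
        \<open>L l j\<close> for l < j, and \<open>D k l\<close> off the diagonal.\<close>
      by (rule sum.mono_neutral_right) (use ij in \<open>auto simp: U_def D_def L_def split: if_splits\<close>)
    also have "\<dots> = skew_gf (subdiagram \<Lambda> i j)"
      unfolding skew_gf_subdiagram[OF assms(1,3) ij]
      by (rule sum.cong) (auto simp: U_def D_def L_def)
    finally show ?thesis by simp
  qed
  have "U_mat \<Lambda> a b * D_mat \<Lambda> a b * L_mat \<Lambda> a b
    = mat1 a b (\<lambda>i j. \<Sum>l = 1..b. (\<Sum>k = 1..a. U i k * D k l) * L l j)"
    unfolding D_mat U_mat_def L_mat_def U_def[symmetric] L_def[symmetric] mat1_mult ..
  also have "\<dots> = A_mat \<Lambda> a b"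
    unfolding A_mat_def mat1_def by (intro cong_mat) (auto simp: entry)
  finally show "A_mat \<Lambda> a b = U_mat \<Lambda> a b * D_mat \<Lambda> a b * L_mat \<Lambda> a b" ..
  \<comment> \<open>The ranges k \<le> u < k and k \<le> v < k are empty, so the diagonal entries of
    both factors equal \<open>skew_gf {} = 1\<close>.\<close>
  have "U_cells \<Lambda> a b k k = {}" "L_cells \<Lambda> a b k k = {}" for k
    by (auto simp: U_cells_def L_cells_def)
  then show "upper_unitriangular (U_mat \<Lambda> a b)" "lower_unitriangular (L_mat \<Lambda> a b)"
    by (auto simp: upper_unitriangular_def lower_unitriangular_def U_mat_def L_mat_def mat1_def)
qed

end
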